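(* Let $E$ be a nonzero real Banach space, let $f : E \times E^* \to\, ]-\infty,\infty]$ be proper, convex and lower semicontinuous, and suppose $f(x,x^* ) \ge \langle x, x^*\rangle$ for all $(x,x^* ) \in E \times E^*$. Then the set $\{(x,x^* ) \in E \times E^* : f(x,x^* ) = \langle x, x^*\rangle\}$ is quasidense in $E \times E^*$ if and only if $$f^*(y^*, y^{**}) \ge \langle y^*, y^{**}\rangle \quad \text{for all } (y^*,y^{**}) \in E^* \times E^{**}.$$
   Context: $E \times E^*$ is normed by $\|(x,x^* )\| := \sqrt{\|x\|^2 + \|x^*\|^2}$, and its dual is $E^* \times E^{**}$ under the pairing $\langle (x,x^* ), (y^*,y^{**})\rangle := \langle x, y^*\rangle + \langle x^*, y^{**}\rangle$. The Fenchel conjugate of $f$ is $f^*(y^*,y^{**}) := \sup_{(x,x^* ) \in E \times E^*}[\langle x, y^*\rangle + \langle x^*, y^{**}\rangle - f(x,x^* )]$. A subset $A \subset E \times E^*$ is quasidense (in $E \times E^*$) if, for all $(x,x^* ) \in E \times E^*$, $\inf_{(s,s^* ) \in A}\big[\frac12\|s-x\|^2 + \frac12\|s^*-x^*\|^2 + \langle s-x, s^*-x^*\rangle\big] \le 0$. A function is proper if it is finite somewhere. *)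

theory Defs
  imports "HOL-Analysis.Analysis"
begin

text \<open>
  The dual of a real normed space, with the operator norm of bounded linear functions.
  The bidual is \<open>'a dual dual\<close>.
\<close>
type_synonym 'a dual = "'a \<Rightarrow>\<^sub>L real"

definition pairing :: "'a::real_normed_vector \<Rightarrow> 'a dual \<Rightarrow> real" where
  "pairing x \<phi> = blinfun_apply \<phi> x"

text \<open>
  A function into \<open>]-\<infinity>,\<infinity>]\<close> is represented by a function into \<^typ>\<open>ereal\<close> that avoids
  \<open>-\<infinity>\<close>. In \<^typ>\<open>ereal\<close>, \<open>-\<infinity> + \<infinity> = \<infinity>\<close>; this case does not arise in the
  convexity inequality for such a function.
\<close>
definition avoids_minf :: "('a \<Rightarrow> ereal) \<Rightarrow> bool" where
  "avoids_minf f \<longleftrightarrow> (\<forall>z. f z \<noteq> -\<infinity>)"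

definition proper_fun :: "('a \<Rightarrow> ereal) \<Rightarrow> bool" where
  "proper_fun f \<longleftrightarrow> (\<exists>z. \<bar>f z\<bar> \<noteq> \<infinity>)"

definition convex_ereal :: "('a::real_vector \<Rightarrow> ereal) \<Rightarrow> bool" where
  "convex_ereal f \<longleftrightarrow>
     (\<forall>x y. \<forall>u>0. \<forall>v>0. u + v = 1 \<longrightarrow>
        f (u *\<^sub>R x + v *\<^sub>R y) \<le> ereal u * f x + ereal v * f y)"

definition lsc :: "('a::topological_space \<Rightarrow> ereal) \<Rightarrow> bool" where
  "lsc f \<longleftrightarrow> (\<forall>x c. c < f x \<longrightarrow> (\<forall>\<^sub>F y in nhds x. c < f y))"

definition fenchel_conj ::
  "('a::real_normed_vector \<times> 'a dual \<Rightarrow> ereal) \<Rightarrow> 'a dual \<times> 'a dual dual \<Rightarrow> ereal" where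
  "fenchel_conj f = (\<lambda>(y', y'').
     SUP (x, x') \<in> UNIV. ereal (pairing x y' + pairing x' y'') - f (x, x'))"

text \<open>
  The infimum is taken in \<^typ>\<open>ereal\<close>, so that it is \<open>\<infinity>\<close> over the empty set, which is
  therefore not quasidense.
\<close>
definition quasidense :: "('a::real_normed_vector \<times> 'a dual) set \<Rightarrow> bool" where
  "quasidense A \<longleftrightarrow>
     (\<forall>x x'. (INF (s, s') \<in> A.
        ereal (1/2 * (norm (s - x))\<^sup>2 + 1/2 * (norm (s' - x'))\<^sup>2 + pairing (s - x) (s' - x'))) \<le> 0)"

end

theory Submission
  imports Defs
begin

text \<open>
  Write \<open>q (x, x') = pairing x x'\<close> on \<open>E \<times> E\<^sup>*\<close> and \<open>r z = \<parallel>z\<parallel>\<^sup>2 / 2 + q z\<close>, which is nonnegative. Then \<open>A\<close>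
  is quasidense if every \<open>c\<close> admits \<open>a \<in> A\<close> with \<open>r (a - c)\<close> arbitrarily small. Let \<open>A\<close> be the set where
  \<open>f = q\<close>.

  If \<open>A\<close> is quasidense and \<open>(y', y'')\<close> is given, take \<open>z' \<in> E\<^sup>*\<close> with norm about \<open>\<parallel>y''\<parallel>\<close> on which \<open>y''\<close>
  is about \<open>- \<parallel>y''\<parallel>\<^sup>2\<close>. A point \<open>(s, s') \<in> A\<close> with \<open>r ((s, s') - (0, y' - z'))\<close> small then satisfies
  \<open>\<langle>s, y'\<rangle> + \<langle>s', y''\<rangle> - q (s, s') \<ge> \<langle>y', y''\<rangle> - \<epsilon>\<close> by completing squares, and its left-hand side is
  at most the conjugate at \<open>(y', y'')\<close>: \<open>quasidense_negative_alignment\<close>.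

  Conversely, suppose that the conjugate dominates the pairing. There are two steps.

  \<^item> For every \<open>c\<close>, \<open>inf b. (f - q) b + r (b - c) \<le> 0\<close> (\<open>gap_plus_gauge_small\<close>). The expression under
    the infimum is \<open>f\<close> plus an affine function plus \<open>\<parallel>b - c\<parallel>\<^sup>2 / 2\<close>, so Fenchel duality rewrites the
    infimum as minus a minimum over the dual, and the hypothesis makes that minimum nonnegative. The
    duality comes from a subgradient of an inf-convolution (\<open>Fenchel_duality_half_norm_squared\<close>),
    which in turn exists by the Hahn-Banach theorem (\<open>Hahn_Banach_sublinear\<close>).

  \<^item> Both summands \<open>f - q\<close> and \<open>r\<close> are nonnegative, so each \<open>c\<close> has a nearby point at which \<open>f\<close> is
    almost \<open>q\<close>, where nearness is measured by \<open>r\<close>. Repeating this from each point found yields a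
    sequence. Convexity gives \<open>- q (b - d) \<le> 2 (f - q) b + 2 (f - q) d\<close>
    (\<open>neg_self_pairing_diff_le\<close>), which makes the sequence Cauchy in norm, and by lower
    semicontinuity its limit lies in \<open>A\<close> (\<open>quasidense_of_gap_plus_gauge_small\<close>).
\<close>

section \<open>Sublinear functionals and the Hahn-Banach theorem\<close>

definition sublinear :: "('v::real_vector \<Rightarrow> real) \<Rightarrow> bool" where
  "sublinear p \<longleftrightarrow>
     (\<forall>x y. p (x + y) \<le> p x + p y) \<and> (\<forall>t\<ge>0. \<forall>x. p (t *\<^sub>R x) = t * p x)"

lemma sublinearI:
  assumes "\<And>x y. p (x + y) \<le> p x + p y"
    and "\<And>t x. t > 0 \<Longrightarrow> p (t *\<^sub>R x) \<le> t * p x"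
    and "p 0 = 0"
  shows "sublinear p"
proof -
  have "p (t *\<^sub>R x) = t * p x" if "t > 0" for t x
  proof (rule antisym)
    have "p ((1/t) *\<^sub>R (t *\<^sub>R x)) \<le> (1/t) * p (t *\<^sub>R x)"
      using assms(2)[of "1/t" "t *\<^sub>R x"] that by simp
    then show "t * p x \<le> p (t *\<^sub>R x)"
      using that by (simp add: field_simps)
  qed (use assms(2) that in blast)
  then have "p (t *\<^sub>R x) = t * p x" if "t \<ge> 0" for t x
    using that assms(3) by (cases "t = 0") auto
  then show ?thesis
    using assms(1) by (simp add: sublinear_def)
qed

lemma sublinear_lower_bound:
  assumes "sublinear p"
  shows "- p (- x) \<le> p x"
proof -
  have "p (x + - x) \<le> p x + p (- x)" and "p (0 *\<^sub>R x) = 0 * p x"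
    using assms unfolding sublinear_def by blast+
  then show ?thesis by simp
qed

text \<open>
  For each \<open>a\<close>, the functional \<open>x \<mapsto> inf t \<ge> 0. (p (x + t a) - t p a)\<close> is again sublinear and below
  \<open>p\<close>, so it equals a minimal \<open>p\<close>; its value is at most the term at \<open>t = 1\<close>, and this is
  superadditivity.
\<close>
lemma minimal_sublinear_imp_linear:
  assumes p: "sublinear p"
    and minimal: "\<And>s. sublinear s \<Longrightarrow> (\<And>x. s x \<le> p x) \<Longrightarrow> s = p"
  shows "linear p"
proof -
  have p_add: "p (x + y) \<le> p x + p y" and p_scale: "t \<ge> 0 \<Longrightarrow> p (t *\<^sub>R x) = t * p x" for t x y
    using p by (auto simp: sublinear_def)
  have p0: "p 0 = 0" using p_scale[of 0 0] by simp
  have superadditive: "p x + p a \<le> p (x + a)" for x a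
  proof -
    define V where "V x = (\<lambda>t. p (x + t *\<^sub>R a) - t * p a) ` {0..}" for x
    define s where "s x = Inf (V x)" for x
    have lower: "- p (- x) \<le> v" if "v \<in> V x" for x v
    proof -
      have "\<exists>t. 0 \<le> t \<and> v = p (x + t *\<^sub>R a) - t * p a"
        using that unfolding V_def image_iff Bex_def atLeast_iff .
      then obtain t where t: "t \<ge> 0" "v = p (x + t *\<^sub>R a) - t * p a" by blast
      have "p (t *\<^sub>R a) \<le> p (x + t *\<^sub>R a) + p (- x)"
        using p_add[of "x + t *\<^sub>R a" "- x"] by simp
      then show ?thesis using t p_scale by simp
    qed
    have bdd: "bdd_below (V x)" for x using lower by (rule bdd_belowI)
    have s_le: "s x \<le> p (x + t *\<^sub>R a) - t * p a" if "t \<ge> 0" for x t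
      unfolding s_def using that by (intro cInf_lower bdd) (auto simp: V_def)
    have s_ge: "m \<le> s x" if "\<And>t. t \<ge> 0 \<Longrightarrow> m \<le> p (x + t *\<^sub>R a) - t * p a" for x m
      unfolding s_def using that by (intro cInf_greatest) (auto simp: V_def)
    have "sublinear s"
    proof (rule sublinearI)
      fix x y
      have "s (x + y) - (p (y + t2 *\<^sub>R a) - t2 * p a) \<le> p (x + t1 *\<^sub>R a) - t1 * p a"
        if "t1 \<ge> 0" "t2 \<ge> 0" for t1 t2
      proof -
        have "s (x + y) \<le> p (x + y + (t1 + t2) *\<^sub>R a) - (t1 + t2) * p a"
          using that by (intro s_le) simp
        moreover have "p (x + y + (t1 + t2) *\<^sub>R a) \<le> p (x + t1 *\<^sub>R a) + p (y + t2 *\<^sub>R a)"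
          using p_add[of "x + t1 *\<^sub>R a" "y + t2 *\<^sub>R a"] by (simp add: algebra_simps)
        ultimately show ?thesis by (simp add: algebra_simps)
      qed
      then have "s (x + y) - (p (y + t2 *\<^sub>R a) - t2 * p a) \<le> s x" if "t2 \<ge> 0" for t2
        using that by (intro s_ge) auto
      then have "s (x + y) - s x \<le> s y" by (intro s_ge) (auto simp: algebra_simps)
      then show "s (x + y) \<le> s x + s y" by simp
    next
      fix t :: real and x assume t: "t > 0"
      have "s (t *\<^sub>R x) / t \<le> s x"
      proof (rule s_ge)
        fix u :: real assume "u \<ge> 0"
        then have "s (t *\<^sub>R x) \<le> p (t *\<^sub>R (x + u *\<^sub>R a)) - (t * u) * p a"
          using s_le[of "t * u" "t *\<^sub>R x"] t by (simp add: scaleR_add_right)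
        then show "s (t *\<^sub>R x) / t \<le> p (x + u *\<^sub>R a) - u * p a"
          using p_scale[of t "x + u *\<^sub>R a"] t by (simp add: field_simps)
      qed
      then show "s (t *\<^sub>R x) \<le> t * s x" using t by (simp add: field_simps)
    next
      have "s 0 \<le> 0" using s_le[of 0 0] p0 by simp
      moreover have "0 \<le> s 0" using p_scale by (intro s_ge) simp
      ultimately show "s 0 = 0" by simp
    qed
    moreover have "s x \<le> p x" for x using s_le[of 0 x] by simp
    ultimately have "s = p" by (rule minimal)
    then show ?thesis using s_le[of 1 x] by simp
  qed
  have add: "p (x + y) = p x + p y" for x y
    using p_add superadditive by (rule antisym)
  have neg: "p (- x) = - p x" for x using add[of x "- x"] p0 by simp
  show ?thesis
  proof (rule linearI)
    show "p (x + y) = p x + p y" for x y by (rule add)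
    show "p (t *\<^sub>R x) = t *\<^sub>R p x" for t x
      using p_scale[of t x] p_scale[of "- t" x] neg[of "t *\<^sub>R x"] by (cases "t \<ge> 0") auto
  qed
qed

text \<open>
  Working with minimal sublinear functionals avoids extending partial functionals one
  dimension at a time. Zorn's lemma applies because the pointwise infimum of a chain is finite:
  every member \<open>s\<close> satisfies \<open>s x \<ge> - s (- x) \<ge> - p (- x)\<close>.
\<close>
theorem Hahn_Banach_sublinear:
  assumes p: "sublinear p"
  obtains l where "linear l" "\<And>x. l x \<le> p x"
proof -
  define A where "A = {s. sublinear s \<and> s \<le> p}"
  let ?P = "\<lambda>s s'. s' \<le> (s :: 'a \<Rightarrow> real)"
  have "\<exists>m\<in>A. \<forall>s\<in>A. ?P m s \<longrightarrow> s = m"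
  proof (rule predicate_Zorn)
    show "partial_order_on A (relation_of ?P A)"
      by (rule partial_order_on_relation_ofI) auto
    fix C assume C: "C \<in> Chains (relation_of ?P A)"
    have sub: "C \<subseteq> A" using C by (rule Chains_relation_of)
    have total: "s \<le> s' \<or> s' \<le> s" if "s \<in> C" "s' \<in> C" for s s'
      using C that by (auto simp: Chains_def relation_of_def)
    show "\<exists>u\<in>A. \<forall>s\<in>C. ?P s u"
    proof (cases "C = {}")
      case True
      then show ?thesis using p by (auto simp: A_def)
    next
      case False
      define u where "u x = (INF s\<in>C. s x)" for x
      have lower: "- p (- x) \<le> s x" if "s \<in> C" for s x
      proof -
        have "sublinear s" "s (- x) \<le> p (- x)" using sub that by (auto simp: A_def le_fun_def)
        then show ?thesis using sublinear_lower_bound[of s x] by linarith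
      qed
      have u_le: "u x \<le> s x" if "s \<in> C" for s x
        unfolding u_def using that lower by (intro cINF_lower bdd_belowI2) auto
      have u_ge: "m \<le> u x" if "\<And>s. s \<in> C \<Longrightarrow> m \<le> s x" for m x
        unfolding u_def using that False by (intro cINF_greatest) auto
      have C_add: "s (x + y) \<le> s x + s y" and C_scale: "t \<ge> 0 \<Longrightarrow> s (t *\<^sub>R x) = t * s x"
        if "s \<in> C" for s t x y
        using sub that by (auto simp: A_def sublinear_def)
      have "sublinear u"
      proof (rule sublinearI)
        fix x y
        \<comment> \<open>the smaller of the two members of the chain bounds both\<close>
        have "u (x + y) - s' y \<le> s x" if "s \<in> C" "s' \<in> C" for s s'
        proof (cases "s \<le> s'")
          case True
          then show ?thesis
            using u_le[OF that(1), of "x + y"] C_add[OF that(1), of x y] le_funD[OF True, of y] by linarith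
        next
          case False
          then have "s' x \<le> s x" using total that by (auto simp: le_fun_def)
          then show ?thesis
            using u_le[OF that(2), of "x + y"] C_add[OF that(2), of x y] by linarith
        qed
        then have "u (x + y) - s' y \<le> u x" if "s' \<in> C" for s' using that by (intro u_ge) auto
        then have "u (x + y) - u x \<le> u y" by (intro u_ge) (auto simp: algebra_simps)
        then show "u (x + y) \<le> u x + u y" by simp
      next
        fix t :: real and x assume t: "t > 0"
        have "u (t *\<^sub>R x) / t \<le> u x"
          using u_le C_scale t by (intro u_ge) (fastforce simp: field_simps)
        then show "u (t *\<^sub>R x) \<le> t * u x" using t by (simp add: field_simps)
      next
        have "s 0 = 0" if "s \<in> C" for s using C_scale[OF that, of 0 0] by simp
        then have "u 0 \<le> 0" "0 \<le> u 0" using False u_le[of _ 0] u_ge[of 0 0] by fastforce+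
        then show "u 0 = 0" by simp
      qed
      moreover have "u \<le> p"
      proof (rule le_funI)
        fix x
        obtain s where s: "s \<in> C" using False by blast
        then have "s x \<le> p x" using sub by (auto simp: A_def le_fun_def)
        then show "u x \<le> p x" using u_le[OF s, of x] by linarith
      qed
      ultimately have "u \<in> A" by (simp add: A_def)
      moreover have "u \<le> s" if "s \<in> C" for s using u_le[OF that] by (rule le_funI)
      ultimately show ?thesis by blast
    qed
  qed
  then obtain m where "m \<in> A" and minimal: "\<forall>s\<in>A. s \<le> m \<longrightarrow> s = m" by blast
  then have m: "sublinear m" "m \<le> p" by (simp_all add: A_def)
  have "s = m" if "sublinear s" "\<And>x. s x \<le> m x" for s
  proof -
    have "s \<le> m" using that(2) by (rule le_funI)
    moreover from this have "s \<in> A" using that(1) m(2) by (simp add: A_def)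
    ultimately show ?thesis using minimal by blast
  qed
  with m(1) have "linear m" by (rule minimal_sublinear_imp_linear)
  then show ?thesis using that le_funD[OF m(2)] by blast
qed

text \<open>
  The directional derivative \<open>v \<mapsto> inf t > 0. (\<phi> (t v) - \<phi> 0) / t\<close> is finite because \<open>\<phi>\<close> is real
  valued on the whole space, and convexity makes it sublinear. A linear functional below it is a
  subgradient at \<open>0\<close>.
\<close>
theorem convex_subgradient_exists:
  fixes \<phi> :: "'v::real_vector \<Rightarrow> real"
  assumes convex: "convex_on UNIV \<phi>"
  obtains l where "linear l" "\<And>v. \<phi> 0 + l v \<le> \<phi> v"
proof -
  define V where "V v = (\<lambda>t. (\<phi> (t *\<^sub>R v) - \<phi> 0) / t) ` {0<..}" for v
  define p where "p v = Inf (V v)" for v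
  have conv: "\<phi> (a *\<^sub>R x + b *\<^sub>R y) \<le> a * \<phi> x + b * \<phi> y" if "a \<ge> 0" "b \<ge> 0" "a + b = 1" for a b x y
    using convex that by (auto simp: convex_on_def)
  have lower: "\<phi> 0 - \<phi> (- v) \<le> (\<phi> (t *\<^sub>R v) - \<phi> 0) / t" if "t > 0" for t v
  proof -
    have "\<phi> ((1 / (1 + t)) *\<^sub>R (t *\<^sub>R v) + (t / (1 + t)) *\<^sub>R (- v))
        \<le> (1 / (1 + t)) * \<phi> (t *\<^sub>R v) + (t / (1 + t)) * \<phi> (- v)"
      using that by (intro conv) (auto simp: field_simps)
    then have "\<phi> 0 \<le> (\<phi> (t *\<^sub>R v) + t * \<phi> (- v)) / (1 + t)"
      by (simp add: add_divide_distrib)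
    then show ?thesis using that by (simp add: field_simps)
  qed
  have bdd: "bdd_below (V v)" for v
    unfolding V_def using lower by (intro bdd_belowI2[where m = "\<phi> 0 - \<phi> (- v)"]) auto
  have p_le: "p v \<le> (\<phi> (t *\<^sub>R v) - \<phi> 0) / t" if "t > 0" for t v
    unfolding p_def using that by (intro cInf_lower bdd) (auto simp: V_def)
  have p_ge: "m \<le> p v" if "\<And>t. t > 0 \<Longrightarrow> m \<le> (\<phi> (t *\<^sub>R v) - \<phi> 0) / t" for m v
    unfolding p_def using that by (intro cInf_greatest) (auto simp: V_def)
  have "sublinear p"
  proof (rule sublinearI)
    fix x y
    have "p (x + y) - (\<phi> (t *\<^sub>R y) - \<phi> 0) / t \<le> (\<phi> (s *\<^sub>R x) - \<phi> 0) / s"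
      if st: "s > 0" "t > 0" for s t
    proof -
      \<comment> \<open>half the harmonic mean: it makes \<open>k (x + y)\<close> a convex combination of \<open>s x\<close> and \<open>t y\<close>\<close>
      define k where "k = s * t / (s + t)"
      have k: "k > 0" and w: "s + t \<noteq> 0" using st by (auto simp: k_def)
      have "\<phi> (k *\<^sub>R (x + y)) = \<phi> ((t / (s + t)) *\<^sub>R (s *\<^sub>R x) + (s / (s + t)) *\<^sub>R (t *\<^sub>R y))"
        by (simp add: k_def scaleR_add_right mult.commute)
      also have "\<dots> \<le> (t / (s + t)) * \<phi> (s *\<^sub>R x) + (s / (s + t)) * \<phi> (t *\<^sub>R y)"
        using st w by (intro conv) (auto simp: add_divide_distrib[symmetric] add.commute)
      finally have "(\<phi> (k *\<^sub>R (x + y)) - \<phi> 0) / k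
          \<le> ((t / (s + t)) * \<phi> (s *\<^sub>R x) + (s / (s + t)) * \<phi> (t *\<^sub>R y) - \<phi> 0) / k"
        using k by (intro divide_right_mono) auto
      also have "\<dots> = (\<phi> (s *\<^sub>R x) - \<phi> 0) / s + (\<phi> (t *\<^sub>R y) - \<phi> 0) / t"
      proof -
        have "((t / (s + t)) * A + (s / (s + t)) * B - C) / k = (A - C) / s + (B - C) / t" for A B C
        proof -
          have "C = (t * C + s * C) / (s + t)"
            using w by (simp add: distrib_right[symmetric] add.commute)
          then have "(t / (s + t)) * A + (s / (s + t)) * B - C
              = (t / (s + t)) * A + (s / (s + t)) * B - (t * C + s * C) / (s + t)" by simp
          also have "\<dots> = (t * (A - C) + s * (B - C)) / (s + t)"
            by (simp add: add_divide_distrib diff_divide_distrib right_diff_distrib)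
          finally have "((t / (s + t)) * A + (s / (s + t)) * B - C) / k = (t * (A - C) + s * (B - C)) / (s * t)"
            using w by (simp add: k_def)
          also have "\<dots> = (A - C) / s + (B - C) / t" using st by (simp add: add_divide_distrib)
          finally show ?thesis .
        qed
        then show ?thesis .
      qed
      finally show ?thesis using p_le[OF k, of "x + y"] by simp
    qed
    then have "p (x + y) - (\<phi> (t *\<^sub>R y) - \<phi> 0) / t \<le> p x" if "t > 0" for t
      using that by (intro p_ge) auto
    then have "p (x + y) - p x \<le> p y" by (intro p_ge) (auto simp: algebra_simps)
    then show "p (x + y) \<le> p x + p y" by simp
  next
    fix t :: real and x assume t: "t > 0"
    have "p (t *\<^sub>R x) / t \<le> p x"
    proof (rule p_ge)
      fix s :: real assume s: "s > 0"
      have "p (t *\<^sub>R x) \<le> (\<phi> ((s / t) *\<^sub>R t *\<^sub>R x) - \<phi> 0) / (s / t)"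
        using s t by (intro p_le) simp
      then show "p (t *\<^sub>R x) / t \<le> (\<phi> (s *\<^sub>R x) - \<phi> 0) / s"
        using s t by (simp add: field_simps)
    qed
    then show "p (t *\<^sub>R x) \<le> t * p x" using t by (simp add: field_simps)
  next
    have "p 0 \<le> 0" using p_le[of 1 0] by simp
    moreover have "0 \<le> p 0" by (intro p_ge) simp
    ultimately show "p 0 = 0" by simp
  qed
  then obtain l where l: "linear l" "\<And>x. l x \<le> p x" by (rule Hahn_Banach_sublinear) blast
  have "\<phi> 0 + l v \<le> \<phi> v" for v
    using l(2)[of v] p_le[of 1 v] by simp
  then show ?thesis using that l(1) by blast
qed

section \<open>Fenchel duality with half the squared norm\<close>

lemma norm_squared_convex:
  fixes x y :: "'v::real_normed_vector"
  assumes "u \<ge> 0" "v \<ge> 0" "u + v = 1"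
  shows "(norm (u *\<^sub>R x + v *\<^sub>R y))\<^sup>2 \<le> u * (norm x)\<^sup>2 + v * (norm y)\<^sup>2"
proof -
  have "norm (u *\<^sub>R x + v *\<^sub>R y) \<le> u * norm x + v * norm y"
    using norm_triangle_ineq[of "u *\<^sub>R x" "v *\<^sub>R y"] assms by simp
  then have "(norm (u *\<^sub>R x + v *\<^sub>R y))\<^sup>2 \<le> (u * norm x + v * norm y)\<^sup>2"
    by (intro power_mono) auto
  also have "\<dots> = u * (norm x)\<^sup>2 + v * (norm y)\<^sup>2 - u * v * (norm x - norm y)\<^sup>2"
  proof -
    have v: "v = 1 - u" using assms by simp
    show ?thesis unfolding v by (simp add: power2_eq_square algebra_simps)
  qed
  also have "\<dots> \<le> u * (norm x)\<^sup>2 + v * (norm y)\<^sup>2" using assms by simp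
  finally show ?thesis .
qed

text \<open>
  The inf-convolution \<open>\<phi> v = inf b \<in> D. F b + \<parallel>b - v\<parallel>\<^sup>2 / 2\<close> is finite and convex on the whole space,
  even though \<open>F\<close> is controlled only on \<open>D\<close>, and \<open>\<phi> 0 \<ge> m\<close>. A subgradient \<open>l\<close> of \<open>\<phi>\<close> at \<open>0\<close> is bounded
  because \<open>\<phi>\<close> is bounded above on the unit ball, and the subgradient inequality at \<open>v = b - w\<close> is the
  claim. Taking the supremum over \<open>b\<close> and the infimum over \<open>w\<close> turns it into the dual statement
  \<open>F\<^sup>* l + \<parallel>l\<parallel>\<^sup>2 / 2 \<le> - m\<close>; keeping \<open>w\<close> explicit means that no conjugate of the norm is needed.
\<close>
theorem Fenchel_duality_half_norm_squared:
  fixes F :: "'v::real_normed_vector \<Rightarrow> real"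
  assumes convex: "convex_on D F"
    and nonempty: "D \<noteq> {}"
    and bound: "\<And>b. b \<in> D \<Longrightarrow> m \<le> F b + (norm b)\<^sup>2 / 2"
  obtains l :: "'v \<Rightarrow>\<^sub>L real"
    where "\<And>b w. b \<in> D \<Longrightarrow> l b - F b \<le> (norm w)\<^sup>2 / 2 + l w - m"
proof -
  define g where "g v b = F b + (norm (b - v))\<^sup>2 / 2" for v b
  define \<phi> where "\<phi> v = (INF b\<in>D. g v b)" for v
  obtain b0 where b0: "b0 \<in> D" using nonempty by blast
  have D: "u *\<^sub>R x + v *\<^sub>R y \<in> D" and F: "F (u *\<^sub>R x + v *\<^sub>R y) \<le> u * F x + v * F y"
    if "x \<in> D" "y \<in> D" "u \<ge> 0" "v \<ge> 0" "u + v = 1" for x y u v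
    using convex that by (auto simp: convex_on_def dest: convexD)
  have g_convex: "g (u *\<^sub>R x + v *\<^sub>R y) (u *\<^sub>R b + v *\<^sub>R d) \<le> u * g x b + v * g y d"
    if "b \<in> D" "d \<in> D" "u \<ge> 0" "v \<ge> 0" "u + v = 1" for x y b d u v
  proof -
    have "u *\<^sub>R b + v *\<^sub>R d - (u *\<^sub>R x + v *\<^sub>R y) = u *\<^sub>R (b - x) + v *\<^sub>R (d - y)"
      by (simp add: algebra_simps)
    then show ?thesis
      using F[OF that] norm_squared_convex[OF that(3-5), of "b - x" "d - y"]
      by (simp add: g_def algebra_simps)
  qed
  \<comment> \<open>midpoint convexity bounds the infimum below: the value at \<open>0\<close> is at most the mean of those at \<open>v\<close> and \<open>- v\<close>\<close>
  have lower: "2 * m - g (- v) b0 \<le> g v b" if "b \<in> D" for v b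
  proof -
    have "m \<le> g ((1/2) *\<^sub>R v + (1/2) *\<^sub>R (- v)) ((1/2) *\<^sub>R b + (1/2) *\<^sub>R b0)"
      using bound[OF D[OF that b0, of "1/2" "1/2"]] by (simp add: g_def)
    also have "\<dots> \<le> 1/2 * g v b + 1/2 * g (- v) b0"
      using that b0 by (intro g_convex) auto
    finally show ?thesis by simp
  qed
  have \<phi>_le: "\<phi> v \<le> g v b" if "b \<in> D" for v b
    unfolding \<phi>_def using that lower by (intro cINF_lower bdd_belowI2) auto
  have \<phi>_ge: "k \<le> \<phi> v" if "\<And>b. b \<in> D \<Longrightarrow> k \<le> g v b" for k v
    unfolding \<phi>_def using that nonempty by (intro cINF_greatest) auto
  have "convex_on UNIV \<phi>"
  proof (rule convex_onI)
    fix t :: real and x y :: 'v assume t: "t > 0" "t < 1"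
    let ?z = "(1 - t) *\<^sub>R x + t *\<^sub>R y"
    have "(\<phi> ?z - t * g y d) / (1 - t) \<le> g x b" if "b \<in> D" "d \<in> D" for b d
    proof -
      have "\<phi> ?z \<le> g ?z ((1 - t) *\<^sub>R b + t *\<^sub>R d)" using D that t by (intro \<phi>_le) auto
      also have "\<dots> \<le> (1 - t) * g x b + t * g y d" using that t by (intro g_convex) auto
      finally show ?thesis using t by (simp add: field_simps)
    qed
    then have "(\<phi> ?z - t * g y d) / (1 - t) \<le> \<phi> x" if "d \<in> D" for d
      using that by (intro \<phi>_ge) auto
    then have "(\<phi> ?z - (1 - t) * \<phi> x) / t \<le> g y d" if "d \<in> D" for d
      using t that by (force simp: field_simps)
    then have "(\<phi> ?z - (1 - t) * \<phi> x) / t \<le> \<phi> y" by (intro \<phi>_ge)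
    then show "\<phi> ?z \<le> (1 - t) * \<phi> x + t * \<phi> y" using t by (simp add: field_simps)
  qed simp
  then obtain l where l: "linear l" and subgradient: "\<And>v. \<phi> 0 + l v \<le> \<phi> v"
    by (rule convex_subgradient_exists) blast
  have "m \<le> \<phi> 0" using bound by (intro \<phi>_ge) (auto simp: g_def)
  then have key: "m + l v \<le> g v b" if "b \<in> D" for v b
    using subgradient[of v] \<phi>_le[OF that, of v] by linarith
  define K where "K = F b0 + (norm b0 + 1)\<^sup>2 / 2 - m"
  have unit: "l v \<le> K" if "norm v = 1" for v
  proof -
    have "(norm (b0 - v))\<^sup>2 \<le> (norm b0 + 1)\<^sup>2"
      using norm_triangle_ineq4[of b0 v] that by (intro power_mono) auto
    then show ?thesis using key[OF b0, of v] unfolding g_def K_def by linarith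
  qed
  have le: "l v \<le> norm v * K" for v
  proof (cases "v = 0")
    case True
    then show ?thesis using linear_0[OF l] by simp
  next
    case False
    then have "l ((1 / norm v) *\<^sub>R v) \<le> K" by (intro unit) simp
    then show ?thesis using False linear_cmul[OF l] by (simp add: field_simps)
  qed
  have "norm (l v) \<le> norm v * K" for v
    using le[of v] le[of "- v"] linear_neg[OF l] by (simp add: abs_le_iff)
  with l have bl: "bounded_linear l"
    by (intro bounded_linear_intro[where K = K]) (auto simp: linear_add linear_cmul)
  show ?thesis
  proof (rule that)
    fix b w assume "b \<in> D"
    from key[OF this, of "b - w"]
    show "Blinfun l b - F b \<le> (norm w)\<^sup>2 / 2 + Blinfun l w - m"
      using l by (simp add: bounded_linear_Blinfun_apply[OF bl] g_def linear_diff)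
  qed
qed

lemma blinfun_almost_norm_attaining:
  fixes \<psi> :: "'v::real_normed_vector \<Rightarrow>\<^sub>L real"
  assumes "\<epsilon> > 0"
  obtains w where "norm w \<le> norm \<psi>" "\<psi> w \<le> \<epsilon> - (norm \<psi>)\<^sup>2"
proof (cases "(norm \<psi>)\<^sup>2 \<le> \<epsilon>")
  case True
  then show ?thesis using that[of 0] by simp
next
  case False
  define N where "N = norm \<psi>"
  have N: "N > 0" "\<epsilon> < N * N" using False assms by (auto simp: N_def power2_eq_square)
  then have pos: "0 \<le> N - \<epsilon> / N" by (simp add: field_simps)
  have "\<exists>x. norm (\<psi> x) > (N - \<epsilon> / N) * norm x"
  proof (rule ccontr)
    assume "\<not> ?thesis"
    then have "norm \<psi> \<le> N - \<epsilon> / N" by (intro norm_blinfun_bound pos) (auto simp: not_less)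
    then show False using divide_pos_pos[OF assms N(1)] by (simp add: N_def)
  qed
  then obtain x where x: "\<bar>\<psi> x\<bar> > (N - \<epsilon> / N) * norm x" by auto
  then have x0: "norm x > 0" by auto
  define w where "w = (- sgn (\<psi> x) * N / norm x) *\<^sub>R x"
  have "norm w \<le> N"
    using x0 N by (simp add: w_def abs_mult abs_sgn_eq)
  moreover have "\<psi> w = - N * (\<bar>\<psi> x\<bar> / norm x)"
    by (simp add: w_def blinfun.scaleR_right blinfun.minus_right abs_sgn mult.commute)
  moreover have "N * (\<bar>\<psi> x\<bar> / norm x) \<ge> N * (N - \<epsilon> / N)"
    using x x0 N by (intro mult_left_mono) (auto simp: field_simps)
  ultimately show ?thesis using that[of w] N by (simp add: N_def power2_eq_square field_simps)
qed

lemma geometric_steps_converge: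
  fixes b :: "nat \<Rightarrow> 'v::banach"
  assumes step: "\<And>n. norm (b (Suc n) - b n) \<le> \<eta> * (1/2) ^ n"
  obtains a where "b \<longlonglongrightarrow> a" "norm (a - b 0) \<le> 2 * \<eta>"
proof -
  have geo: "(\<lambda>n. \<eta> * (1/2) ^ n) sums (\<eta> * (1 / (1 - 1/2)))"
    by (intro sums_mult geometric_sums) simp
  let ?d = "\<lambda>n. b (Suc n) - b n"
  have "summable ?d"
    using sums_summable[OF geo] step by (rule summable_comparison_test'[of _ 0])
  then have "(\<lambda>n. \<Sum>k<n. ?d k) \<longlonglongrightarrow> suminf ?d" by (rule summable_LIMSEQ)
  then have "(\<lambda>n. b n - b 0) \<longlonglongrightarrow> suminf ?d" by (simp add: sum_lessThan_telescope)
  then have "(\<lambda>n. b n - b 0 + b 0) \<longlonglongrightarrow> suminf ?d + b 0" by (intro tendsto_intros)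
  then have "b \<longlonglongrightarrow> suminf ?d + b 0" by simp
  moreover have "norm (suminf ?d) \<le> (\<Sum>n. \<eta> * (1/2) ^ n)"
    using step sums_summable[OF geo] by (rule norm_suminf_le)
  ultimately show ?thesis using that sums_unique[OF geo] by simp
qed

section \<open>The duality pairing as a quadratic form\<close>

text \<open>
  On \<open>E \<times> E\<^sup>*\<close> the pairing is a quadratic form \<open>q\<close>; \<open>cross_pairing\<close> is its polar form, and
  \<open>pairing_gauge\<close> is the quantity whose infimum decides quasidensity.
\<close>
definition self_pairing :: "'a::real_normed_vector \<times> 'a dual \<Rightarrow> real" where
  "self_pairing z = pairing (fst z) (snd z)"

definition cross_pairing :: "'a::real_normed_vector \<times> 'a dual \<Rightarrow> 'a \<times> 'a dual \<Rightarrow> real" where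
  "cross_pairing u v = pairing (fst u) (snd v) + pairing (fst v) (snd u)"

definition pairing_gauge :: "'a::real_normed_vector \<times> 'a dual \<Rightarrow> real" where
  "pairing_gauge z = (norm z)\<^sup>2 / 2 + self_pairing z"

lemma self_pairing_add: "self_pairing (u + v) = self_pairing u + self_pairing v + cross_pairing u v"
  by (simp add: self_pairing_def cross_pairing_def pairing_def blinfun.add_left blinfun.add_right)

lemma self_pairing_scaleR: "self_pairing (t *\<^sub>R u) = t\<^sup>2 * self_pairing u"
  by (simp add: self_pairing_def pairing_def blinfun.scaleR_left blinfun.scaleR_right power2_eq_square)

lemma self_pairing_minus [simp]: "self_pairing (- u) = self_pairing u"
  by (simp add: self_pairing_def pairing_def blinfun.minus_left blinfun.minus_right)

lemma cross_pairing_linear: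
  "cross_pairing (u + v) w = cross_pairing u w + cross_pairing v w"
  "cross_pairing (t *\<^sub>R u) w = t * cross_pairing u w"
  "cross_pairing u (- w) = - cross_pairing u w"
  by (simp_all add: cross_pairing_def pairing_def blinfun.add_left blinfun.add_right
      blinfun.scaleR_left blinfun.scaleR_right blinfun.minus_left blinfun.minus_right algebra_simps)

lemma cross_pairing_same: "cross_pairing u u = 2 * self_pairing u"
  by (simp add: self_pairing_def cross_pairing_def)

lemma abs_pairing_le: "\<bar>pairing x \<phi>\<bar> \<le> norm x * norm \<phi>"
  using norm_blinfun[of \<phi> x] by (simp add: pairing_def mult.commute)

lemma abs_cross_pairing_le: "\<bar>cross_pairing u v\<bar> \<le> norm u * norm v"
proof -
  let ?a = "norm (fst u)" and ?b = "norm (snd u)" and ?c = "norm (fst v)" and ?d = "norm (snd v)"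
  have "\<bar>cross_pairing u v\<bar> \<le> ?a * ?d + ?c * ?b"
    using abs_pairing_le[of "fst u" "snd v"] abs_pairing_le[of "fst v" "snd u"]
    by (simp add: cross_pairing_def)
  also have "\<dots> \<le> sqrt ((?a\<^sup>2 + ?b\<^sup>2) * (?c\<^sup>2 + ?d\<^sup>2))"
  proof (rule real_le_rsqrt)
    have "0 \<le> (?a * ?c - ?b * ?d)\<^sup>2" by simp
    then show "(?a * ?d + ?c * ?b)\<^sup>2 \<le> (?a\<^sup>2 + ?b\<^sup>2) * (?c\<^sup>2 + ?d\<^sup>2)"
      by (simp add: power2_eq_square algebra_simps)
  qed
  also have "\<dots> = norm u * norm v" by (simp add: norm_prod_def real_sqrt_mult)
  finally show ?thesis .
qed

lemma pairing_gauge_nonneg: "0 \<le> pairing_gauge z"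
  using abs_cross_pairing_le[of z z] by (simp add: pairing_gauge_def cross_pairing_same power2_eq_square)

lemma quasidense_iff:
  "quasidense A \<longleftrightarrow> (\<forall>c. \<forall>\<epsilon>>0. \<exists>a\<in>A. pairing_gauge (a - c) \<le> \<epsilon>)"
proof -
  have expand: "(1/2 * (norm (s - x))\<^sup>2 + 1/2 * (norm (s' - x'))\<^sup>2 + pairing (s - x) (s' - x'))
      = pairing_gauge ((s, s') - (x, x'))" for s x :: 'a and s' x'
    by (simp add: pairing_gauge_def self_pairing_def norm_prod_def)
  have real: "(\<forall>y>0. \<exists>a\<in>A. ereal (pairing_gauge (a - c)) < y) \<longleftrightarrow> (\<forall>\<epsilon>>0. \<exists>a\<in>A. pairing_gauge (a - c) \<le> \<epsilon>)" for c
  proof safe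
    fix \<epsilon> :: real assume "\<forall>y>0. \<exists>a\<in>A. ereal (pairing_gauge (a - c)) < y" "\<epsilon> > 0"
    moreover from this have "0 < ereal \<epsilon>" by simp
    ultimately have "\<exists>a\<in>A. ereal (pairing_gauge (a - c)) < ereal \<epsilon>" by blast
    then show "\<exists>a\<in>A. pairing_gauge (a - c) \<le> \<epsilon>" by (auto intro: less_imp_le)
  next
    fix y :: ereal assume *: "\<forall>\<epsilon>>0. \<exists>a\<in>A. pairing_gauge (a - c) \<le> \<epsilon>" and "y > 0"
    obtain \<epsilon> where \<epsilon>: "0 < ereal \<epsilon>" "ereal \<epsilon> < y" using ereal_dense2[OF \<open>y > 0\<close>] by auto
    then obtain a where "a \<in> A" "pairing_gauge (a - c) \<le> \<epsilon>" using * by auto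
    moreover have "ereal (pairing_gauge (a - c)) < y"
      using \<open>pairing_gauge (a - c) \<le> \<epsilon>\<close> \<epsilon>(2) by (meson ereal_less_eq(3) order.strict_trans1)
    ultimately show "\<exists>a\<in>A. ereal (pairing_gauge (a - c)) < y" by blast
  qed
  show ?thesis
    unfolding quasidense_def expand case_prod_beta' prod.collapse INF_le_iff
    using real by (metis surj_pair)
qed

text \<open>
  At the midpoint \<open>m\<close> of \<open>b\<close> and \<open>d\<close>, convexity bounds \<open>F m\<close> above by the mean of \<open>F b\<close> and \<open>F d\<close>,
  while \<open>q m\<close> exceeds the mean of \<open>q b\<close> and \<open>q d\<close> by \<open>- q (b - d) / 4\<close> and is at most \<open>F m\<close>. So
  points where \<open>F\<close> is close to \<open>q\<close> are almost monotonically related. Since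
  \<open>\<parallel>b - d\<parallel>\<^sup>2 / 2 = pairing_gauge (b - d) - q (b - d)\<close>, this converts a small gauge into a small norm.
\<close>
lemma neg_self_pairing_diff_le:
  assumes convex: "convex_on D F"
    and ge: "\<And>z. z \<in> D \<Longrightarrow> self_pairing z \<le> F z"
    and "b \<in> D" "d \<in> D"
  shows "- self_pairing (b - d) \<le> 2 * (F b - self_pairing b) + 2 * (F d - self_pairing d)"
proof -
  let ?m = "(1/2) *\<^sub>R b + (1/2) *\<^sub>R d"
  have "?m \<in> D"
    using convexD[OF convex_on_imp_convex[OF convex] assms(3,4), of "1/2" "1/2"] by simp
  then have "self_pairing ?m \<le> F ?m" by (rule ge)
  also have "\<dots> \<le> 1/2 * F b + 1/2 * F d"
    using convex_onD[OF convex, of "1/2" b d] assms(3,4) by simp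
  finally have "self_pairing b / 4 + self_pairing d / 4 + cross_pairing b d / 4 \<le> F b / 2 + F d / 2"
    using cross_pairing_linear(2)[of "1/2" b "(1/2) *\<^sub>R d"]
      cross_pairing_linear(2)[of "1/2" d b]
    by (simp add: self_pairing_add self_pairing_scaleR power2_eq_square cross_pairing_def pairing_def
       blinfun.scaleR_left blinfun.scaleR_right add_divide_distrib)
  moreover have "self_pairing (b - d) = self_pairing b + self_pairing d - cross_pairing b d"
    using self_pairing_add[of b "- d"] by (simp add: cross_pairing_linear)
  ultimately show ?thesis by simp
qed

section \<open>From the conjugate inequality to quasidensity\<close>

text \<open>
  Move \<open>c\<close> to the origin: with \<open>G z = F (z + c) - cross_pairing z c - q c\<close>, the quantity to be made
  small is \<open>G z + \<parallel>z\<parallel>\<^sup>2 / 2\<close>. If it were everywhere above \<open>\<epsilon>\<close>, duality would give \<open>l = (y', y'')\<close> with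
  \<open>G\<^sup>* l + \<parallel>l\<parallel>\<^sup>2 / 2 \<le> - \<epsilon>\<close>. The hypothesis \<open>F\<^sup>* \<ge> pairing\<close> is invariant under this translation, so
  \<open>G\<^sup>* l \<ge> pairing y' y'' \<ge> - \<parallel>y'\<parallel> \<parallel>y''\<parallel>\<close>, and these two bounds contradict each other.
\<close>
lemma gap_plus_gauge_small:
  fixes F :: "'a::real_normed_vector \<times> 'a dual \<Rightarrow> real"
  assumes convex: "convex_on D F"
    and nonempty: "D \<noteq> {}"
    and conj_ge: "\<And>y' y'' M. (\<And>x x'. (x, x') \<in> D \<Longrightarrow> pairing x y' + pairing x' y'' - F (x, x') \<le> M)
      \<Longrightarrow> pairing y' y'' \<le> M"
    and "\<epsilon> > 0"
  shows "\<exists>b\<in>D. F b - self_pairing b + pairing_gauge (b - c) \<le> \<epsilon>"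
proof (rule ccontr)
  assume contra: "\<not> ?thesis"
  define D' where "D' = (\<lambda>b. b - c) ` D"
  define G where "G z = F (z + c) - cross_pairing z c - self_pairing c" for z
  have D'_iff: "z \<in> D' \<longleftrightarrow> z + c \<in> D" for z
    unfolding D'_def image_iff by (metis add_diff_cancel diff_add_cancel)
  have G_convex: "convex_on D' G"
  proof (rule convex_onI)
    show "convex D'" unfolding D'_def
      using convex_translation_subtract[OF convex_on_imp_convex[OF convex]] by simp
    fix t :: real and x y assume "t > 0" "t < 1" "x \<in> D'" "y \<in> D'"
    then have "F ((1 - t) *\<^sub>R (x + c) + t *\<^sub>R (y + c)) \<le> (1 - t) * F (x + c) + t * F (y + c)"
      by (intro convex_onD[OF convex]) (auto simp: D'_iff)
    moreover have "(1 - t) *\<^sub>R (x + c) + t *\<^sub>R (y + c) = (1 - t) *\<^sub>R x + t *\<^sub>R y + c"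
      by (simp add: algebra_simps)
    moreover have "cross_pairing ((1 - t) *\<^sub>R x + t *\<^sub>R y) c
        = (1 - t) * cross_pairing x c + t * cross_pairing y c"
      by (simp add: cross_pairing_linear)
    moreover have "(1 - t) * (A - B - C) + t * (A' - B' - C)
        = ((1 - t) * A + t * A') - ((1 - t) * B + t * B') - C" for A A' B B' C :: real
      by (simp add: algebra_simps)
    ultimately show "G ((1 - t) *\<^sub>R x + t *\<^sub>R y) \<le> (1 - t) * G x + t * G y"
      by (simp add: G_def)
  qed
  have D'_nonempty: "D' \<noteq> {}" using nonempty by (simp add: D'_def)
  have G_bound: "\<epsilon> \<le> G z + (norm z)\<^sup>2 / 2" if "z \<in> D'" for z
  proof -
    have "\<epsilon> < F (z + c) - self_pairing (z + c) + pairing_gauge (z + c - c)"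
      using contra that by (auto simp: D'_iff not_le)
    then show ?thesis by (simp add: G_def pairing_gauge_def self_pairing_add)
  qed
  obtain l :: "('a \<times> 'a dual) \<Rightarrow>\<^sub>L real"
    where l: "\<And>z w. z \<in> D' \<Longrightarrow> l z - G z \<le> (norm w)\<^sup>2 / 2 + l w - \<epsilon>"
    using Fenchel_duality_half_norm_squared[OF G_convex D'_nonempty G_bound] by blast
  define y' where "y' = Blinfun (\<lambda>x. l (x, 0))"
  define y'' where "y'' = Blinfun (\<lambda>x'. l (0, x'))"
  \<comment> \<open>the canonical image in the bidual of the first component of \<open>c\<close>\<close>
  define J where "J = Blinfun (\<lambda>x' :: 'a dual. blinfun_apply x' (fst c))"
  have y': "y' x = l (x, 0)" for x
    unfolding y'_def by (subst bounded_linear_Blinfun_apply) (auto intro!: bounded_linear_intros bounded_linear_Pair)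
  have y'': "y'' x' = l (0, x')" for x'
    unfolding y''_def by (subst bounded_linear_Blinfun_apply) (auto intro!: bounded_linear_intros bounded_linear_Pair)
  have J: "J x' = x' (fst c)" for x'
    unfolding J_def by (subst bounded_linear_Blinfun_apply) (auto intro!: blinfun.bounded_linear_left)
  have l_eq: "l z = y' (fst z) + y'' (snd z)" for z
    unfolding y' y'' blinfun.add_right[symmetric] by simp
  \<comment> \<open>\<open>(w1, w2)\<close> almost attains the infimum \<open>- \<parallel>l\<parallel>\<^sup>2 / 2\<close> of \<open>\<parallel>w\<parallel>\<^sup>2 / 2 + l w\<close>\<close>
  obtain w1 where w1: "norm w1 \<le> norm y'" "y' w1 \<le> \<epsilon> / 3 - (norm y')\<^sup>2"
    using blinfun_almost_norm_attaining[of "\<epsilon> / 3" y'] \<open>\<epsilon> > 0\<close> by auto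
  obtain w2 where w2: "norm w2 \<le> norm y''" "y'' w2 \<le> \<epsilon> / 3 - (norm y'')\<^sup>2"
    using blinfun_almost_norm_attaining[of "\<epsilon> / 3" y''] \<open>\<epsilon> > 0\<close> by auto
  have "(norm (w1, w2))\<^sup>2 \<le> (norm y')\<^sup>2 + (norm y'')\<^sup>2"
    using w1(1) w2(1) by (simp add: norm_Pair add_mono power_mono)
  then have w: "(norm (w1, w2))\<^sup>2 / 2 + l (w1, w2) - \<epsilon> \<le> - \<epsilon> / 3 - (norm y')\<^sup>2 / 2 - (norm y'')\<^sup>2 / 2"
    using w1(2) w2(2) by (simp add: l_eq)
  have "pairing (y' + snd c) (y'' + J)
      \<le> l c + self_pairing c - \<epsilon> / 3 - (norm y')\<^sup>2 / 2 - (norm y'')\<^sup>2 / 2"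
  proof (rule conj_ge)
    fix x x' assume "(x, x') \<in> D"
    then have "l ((x, x') - c) - G ((x, x') - c) \<le> (norm (w1, w2))\<^sup>2 / 2 + l (w1, w2) - \<epsilon>"
      by (intro l) (simp add: D'_iff)
    moreover have "cross_pairing ((x, x') - c) c = cross_pairing (x, x') c - 2 * self_pairing c"
      using cross_pairing_linear(1)[of "(x, x') - c" c c] by (simp add: cross_pairing_same)
    moreover have "pairing x (y' + snd c) + pairing x' (y'' + J) = l (x, x') + cross_pairing (x, x') c"
      by (simp add: pairing_def l_eq cross_pairing_def J blinfun.add_left)
    ultimately show "pairing x (y' + snd c) + pairing x' (y'' + J) - F (x, x')
        \<le> l c + self_pairing c - \<epsilon> / 3 - (norm y')\<^sup>2 / 2 - (norm y'')\<^sup>2 / 2"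
      using w by (simp add: G_def blinfun.diff_right)
  qed
  moreover have "pairing (y' + snd c) (y'' + J) = pairing y' y'' + l c + self_pairing c"
    by (simp add: pairing_def l_eq J self_pairing_def blinfun.add_left blinfun.add_right)
  ultimately have "pairing y' y'' + (norm y')\<^sup>2 / 2 + (norm y'')\<^sup>2 / 2 < 0"
    using \<open>\<epsilon> > 0\<close> by simp
  moreover have "- pairing y' y'' \<le> norm y' * norm y''" using abs_pairing_le[of y' y''] by simp
  moreover have "0 \<le> (norm y' - norm y'')\<^sup>2" by simp
  ultimately show False by (simp add: power2_diff)
qed

lemma pairing_gauge_add_le:
  "pairing_gauge (u + h) \<le> pairing_gauge u + 2 * norm h * norm u + (norm h)\<^sup>2"
proof -
  have "(norm (u + h))\<^sup>2 \<le> (norm u + norm h)\<^sup>2"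
    by (intro power_mono norm_triangle_ineq) simp
  then have "(norm (u + h))\<^sup>2 \<le> (norm u)\<^sup>2 + 2 * norm h * norm u + (norm h)\<^sup>2"
    by (simp add: power2_sum algebra_simps)
  moreover have "cross_pairing u h \<le> norm h * norm u"
    using abs_cross_pairing_le[of u h] by (simp add: mult.commute)
  moreover have "2 * self_pairing h \<le> (norm h)\<^sup>2"
    using abs_cross_pairing_le[of h h] by (simp add: cross_pairing_same power2_eq_square)
  ultimately show ?thesis by (simp add: pairing_gauge_def self_pairing_add)
qed

text \<open>
  Comparing \<open>b\<close> with a fixed \<open>d \<in> D\<close> bounds \<open>- q (b - d)\<close>, hence \<open>- q (b - c)\<close> up to a term linear in
  \<open>\<parallel>b - c\<parallel>\<close>; but \<open>\<parallel>b - c\<parallel>\<^sup>2 / 2\<close> is at most \<open>1 - q (b - c)\<close>. The bound \<open>M\<close> depends on \<open>c\<close> alone, so it can be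
  fixed before the accuracy of an approximation is chosen.
\<close>
lemma gap_plus_gauge_sublevel_bounded:
  assumes convex: "convex_on D F"
    and ge: "\<And>z. z \<in> D \<Longrightarrow> self_pairing z \<le> F z"
    and nonempty: "D \<noteq> {}"
  obtains M where "M \<ge> 0"
    "\<And>b. b \<in> D \<Longrightarrow> F b - self_pairing b + pairing_gauge (b - c) \<le> 1 \<Longrightarrow> norm (b - c) \<le> M"
proof -
  obtain d where d: "d \<in> D" using nonempty by blast
  define e where "e z = F z - self_pairing z" for z
  define k where "k = norm (d - c)"
  define K where "K = 3 + 2 * e d + 3 * k\<^sup>2 / 2"
  have e_nonneg: "z \<in> D \<Longrightarrow> 0 \<le> e z" for z using ge by (simp add: e_def)
  have "norm (b - c) \<le> max 1 (2 * (K + k))"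
    if b: "b \<in> D" and small: "F b - self_pairing b + pairing_gauge (b - c) \<le> 1" for b
  proof -
    define t where "t = norm (b - c)"
    have "t\<^sup>2 / 2 + self_pairing (b - c) \<le> 1" "e b \<le> 1"
      using small e_nonneg[OF b] pairing_gauge_nonneg[of "b - c"]
      by (auto simp: e_def pairing_gauge_def t_def)
    moreover have "self_pairing (b - c)
        = self_pairing (b - d) + self_pairing (d - c) + cross_pairing (b - d) (d - c)"
      using self_pairing_add[of "b - d" "d - c"] by simp
    moreover have "- self_pairing (b - d) \<le> 2 * e b + 2 * e d"
      unfolding e_def using neg_self_pairing_diff_le[OF convex ge b d] .
    moreover have "- self_pairing (d - c) \<le> k\<^sup>2 / 2"
      using pairing_gauge_nonneg[of "d - c"] by (simp add: pairing_gauge_def k_def)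
    moreover have "- cross_pairing (b - d) (d - c) \<le> (t + k) * k"
    proof -
      have "norm (b - d) \<le> t + k"
        using norm_triangle_ineq4[of "b - c" "d - c"] by (simp add: t_def k_def)
      then have "norm (b - d) * k \<le> (t + k) * k" by (intro mult_right_mono) (auto simp: k_def)
      then show ?thesis using abs_cross_pairing_le[of "b - d" "d - c"] by (simp add: k_def)
    qed
    ultimately have "t\<^sup>2 / 2 \<le> K + k * t"
      by (simp add: K_def power2_eq_square algebra_simps)
    moreover have "K \<ge> 0" using e_nonneg[OF d] by (simp add: K_def)
    moreover have "K * 1 \<le> K * t" if "1 \<le> t" using that \<open>K \<ge> 0\<close> by (intro mult_left_mono)
    ultimately have "t * t \<le> (2 * (K + k)) * t" if "1 \<le> t"
      using that by (simp add: power2_eq_square algebra_simps)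
    then have "t \<le> max 1 (2 * (K + k))" by (cases "1 \<le> t") auto
    then show ?thesis by (simp add: t_def)
  qed
  then show ?thesis using that[of "max 1 (2 * (K + k))"] by simp
qed

text \<open>
  Completeness upgrades approximate coincidence to coincidence. Starting near \<open>c\<close>, choose each
  \<open>b (n + 1)\<close> by \<open>small\<close> with centre \<open>b n\<close> and accuracy decreasing like \<open>4\<^sup>-\<^sup>n\<close>. Consecutive points have
  small gap \<open>F - q\<close> and small gauge difference, so by the midpoint estimate their distance decreases
  like \<open>2\<^sup>-\<^sup>n\<close>. The limit lies in \<open>A\<close> and is within \<open>2 \<eta>\<close> of \<open>b 0\<close>, whose gauge distance from \<open>c\<close> is
  small. The gauge is only locally Lipschitz, so passing from \<open>b 0\<close> to the limit needs the bound on
  \<open>\<parallel>b 0 - c\<parallel>\<close> before \<open>\<eta>\<close> is fixed.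
\<close>
lemma quasidense_of_gap_plus_gauge_small:
  fixes F :: "'a::banach \<times> 'a dual \<Rightarrow> real"
  assumes convex: "convex_on D F"
    and ge: "\<And>z. z \<in> D \<Longrightarrow> self_pairing z \<le> F z"
    and nonempty: "D \<noteq> {}"
    and closed: "\<And>b a. (\<And>n. b n \<in> D) \<Longrightarrow> b \<longlonglongrightarrow> a \<Longrightarrow> (\<lambda>n. F (b n) - self_pairing (b n)) \<longlonglongrightarrow> 0 \<Longrightarrow> a \<in> A"
    and small: "\<And>c \<epsilon>. \<epsilon> > 0 \<Longrightarrow> \<exists>b\<in>D. F b - self_pairing b + pairing_gauge (b - c) \<le> \<epsilon>"
  shows "quasidense A"
  unfolding quasidense_iff
proof (intro allI impI)
  fix c and \<epsilon> :: real assume "\<epsilon> > 0"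
  obtain M where M: "M \<ge> 0"
    "\<And>b. b \<in> D \<Longrightarrow> F b - self_pairing b + pairing_gauge (b - c) \<le> 1 \<Longrightarrow> norm (b - c) \<le> M"
    using gap_plus_gauge_sublevel_bounded[OF convex ge nonempty] by blast
  define e where "e z = F z - self_pairing z" for z
  have e_nonneg: "z \<in> D \<Longrightarrow> 0 \<le> e z" for z using ge by (simp add: e_def)
  \<comment> \<open>the total error below is \<open>\<eta> + 4 \<eta> M + 4 \<eta>\<^sup>2\<close>\<close>
  define \<eta> where "\<eta> = min 1 (\<epsilon> / (4 * M + 5))"
  have \<eta>: "0 < \<eta>" "\<eta> \<le> 1" "\<eta> * (4 * M + 5) \<le> \<epsilon>"
  proof -
    have "4 * M + 5 > 0" using M(1) by simp
    then show "0 < \<eta>" "\<eta> \<le> 1" "\<eta> * (4 * M + 5) \<le> \<epsilon>"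
      using \<open>\<epsilon> > 0\<close> by (auto simp: \<eta>_def pos_le_divide_eq[symmetric])
  qed
  define \<delta> where "\<delta> n = \<eta>\<^sup>2 / 8 * (1/4) ^ n" for n :: nat
  have \<delta>: "\<delta> n > 0" "\<delta> (Suc n) = \<delta> n / 4" for n using \<eta> by (simp_all add: \<delta>_def)
  have "\<exists>b. \<forall>n. (b n \<in> D \<and> e (b n) \<le> \<delta> n \<and> (n = 0 \<longrightarrow> e (b n) + pairing_gauge (b n - c) \<le> \<delta> n))
      \<and> pairing_gauge (b (Suc n) - b n) \<le> \<delta> (Suc n)"
  proof (rule dependent_nat_choice)
    obtain b where "b \<in> D" "e b + pairing_gauge (b - c) \<le> \<delta> 0"
      using small[OF \<delta>(1)[of 0], of c] by (auto simp: e_def)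
    then show "\<exists>b. b \<in> D \<and> e b \<le> \<delta> 0 \<and> ((0::nat) = 0 \<longrightarrow> e b + pairing_gauge (b - c) \<le> \<delta> 0)"
      using pairing_gauge_nonneg[of "b - c"] by (intro exI[of _ b]) auto
    fix b and n :: nat
    obtain b' where "b' \<in> D" "e b' + pairing_gauge (b' - b) \<le> \<delta> (Suc n)"
      using small[OF \<delta>(1)[of "Suc n"], of b] by (auto simp: e_def)
    then show "\<exists>b'. (b' \<in> D \<and> e b' \<le> \<delta> (Suc n) \<and> (Suc n = 0 \<longrightarrow> e b' + pairing_gauge (b' - c) \<le> \<delta> (Suc n)))
        \<and> pairing_gauge (b' - b) \<le> \<delta> (Suc n)"
      using pairing_gauge_nonneg[of "b' - b"] e_nonneg[of b'] by (intro exI[of _ b']) auto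
  qed
  then obtain b where b: "\<And>n. b n \<in> D" "\<And>n. e (b n) \<le> \<delta> n"
    "e (b 0) + pairing_gauge (b 0 - c) \<le> \<delta> 0" "\<And>n. pairing_gauge (b (Suc n) - b n) \<le> \<delta> (Suc n)"
    by metis
  have step: "norm (b (Suc n) - b n) \<le> \<eta> * (1/2) ^ n" for n
  proof (rule power2_le_imp_le)
    have "- self_pairing (b (Suc n) - b n) \<le> 2 * e (b (Suc n)) + 2 * e (b n)"
      unfolding e_def by (rule neg_self_pairing_diff_le[OF convex ge b(1) b(1)])
    then have "(norm (b (Suc n) - b n))\<^sup>2 \<le> 2 * (\<delta> (Suc n) + 2 * \<delta> (Suc n) + 2 * \<delta> n)"
      using b(2)[of n] b(2)[of "Suc n"] b(4)[of n] by (simp add: pairing_gauge_def)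
    also have "\<dots> \<le> 8 * \<delta> n" using \<delta>(1)[of n] by (simp add: \<delta>(2))
    also have "\<dots> = (\<eta> * (1/2) ^ n)\<^sup>2"
    proof -
      have "((1/2) ^ n)\<^sup>2 = (1/4 :: real) ^ n"
        by (simp add: power2_eq_square flip: power_mult_distrib)
      then show ?thesis by (simp add: \<delta>_def power_mult_distrib)
    qed
    finally show "(norm (b (Suc n) - b n))\<^sup>2 \<le> (\<eta> * (1/2) ^ n)\<^sup>2" .
  qed (use \<eta> in simp)
  then obtain a where a: "b \<longlonglongrightarrow> a" "norm (a - b 0) \<le> 2 * \<eta>"
    using geometric_steps_converge[of b \<eta>] by blast
  have "\<delta> \<longlonglongrightarrow> \<eta>\<^sup>2 / 8 * 0"
    unfolding \<delta>_def by (intro tendsto_intros LIMSEQ_power_zero) simp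
  then have "\<delta> \<longlonglongrightarrow> 0" by simp
  then have "(\<lambda>n. e (b n)) \<longlonglongrightarrow> 0"
    by (rule tendsto_sandwich[OF always_eventually always_eventually tendsto_const, rotated -1])
      (simp_all add: b(2) e_nonneg[OF b(1)])
  then have "a \<in> A" unfolding e_def by (rule closed[OF b(1) a(1)])
  moreover have "pairing_gauge (a - c) \<le> \<epsilon>"
  proof -
    have "\<eta>\<^sup>2 \<le> \<eta>" using \<eta> by (simp add: power2_eq_square mult_left_le)
    then have \<delta>0: "\<delta> 0 \<le> \<eta>" "\<delta> 0 \<le> 1" using \<eta> by (auto simp: \<delta>_def)
    then have "norm (b 0 - c) \<le> M" using b(3) by (intro M(2) b(1)) (simp add: e_def)
    then have "norm (a - b 0) * norm (b 0 - c) \<le> (2 * \<eta>) * M"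
      using a(2) M(1) \<eta>(1) by (intro mult_mono) auto
    moreover have "(norm (a - b 0))\<^sup>2 \<le> (2 * \<eta>)\<^sup>2" using a(2) by (intro power_mono) auto
    moreover have "pairing_gauge (a - c) \<le> pairing_gauge (b 0 - c)
        + 2 * norm (a - b 0) * norm (b 0 - c) + (norm (a - b 0))\<^sup>2"
      using pairing_gauge_add_le[of "b 0 - c" "a - b 0"] by simp
    moreover have "pairing_gauge (b 0 - c) \<le> \<eta>" using b(3) e_nonneg[OF b(1), of 0] \<delta>0 by simp
    ultimately have "pairing_gauge (a - c) \<le> \<eta> + 4 * (\<eta> * M) + 4 * \<eta>\<^sup>2"
      by (simp add: power_mult_distrib)
    also have "\<dots> \<le> \<eta> * (4 * M + 5)" using \<open>\<eta>\<^sup>2 \<le> \<eta>\<close> by (simp add: algebra_simps)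
    finally show ?thesis using \<eta>(3) by simp
  qed
  ultimately show "\<exists>a\<in>A. pairing_gauge (a - c) \<le> \<epsilon>" by blast
qed

section \<open>From quasidensity to the conjugate inequality\<close>

text \<open>
  The element \<open>y''\<close> need not be close to \<open>E\<close>, but only its alignment matters. Choose \<open>z'\<close> in \<open>E\<^sup>*\<close> with
  \<open>\<parallel>z'\<parallel> \<le> \<parallel>y''\<parallel> = m\<close> and \<open>y'' z'\<close> almost \<open>- m\<^sup>2\<close>, and approximate \<open>(0, y' - z')\<close> by \<open>(s, s') \<in> A\<close> in the
  gauge. With \<open>w = s' - y' + z'\<close>, the value at \<open>s' - y' = w - z'\<close> of the functional \<open>s - y''\<close> is
  \<open>w s - z' s - y'' w + y'' z'\<close>, at most \<open>- (\<parallel>s\<parallel> - m)\<^sup>2 / 2 - (\<parallel>w\<parallel> - m)\<^sup>2 / 2\<close> up to \<open>\<epsilon>\<close>.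
\<close>
lemma quasidense_negative_alignment:
  assumes dense: "quasidense A" and "\<epsilon> > 0"
  shows "\<exists>(s, s')\<in>A. pairing y' y'' - \<epsilon> \<le> pairing s y' + pairing s' y'' - pairing s s'"
proof -
  define m where "m = norm y''"
  obtain z' where z': "norm z' \<le> m" "y'' z' \<le> \<epsilon> / 2 - m\<^sup>2"
    using blinfun_almost_norm_attaining[of "\<epsilon> / 2" y''] \<open>\<epsilon> > 0\<close> by (auto simp: m_def)
  obtain a where a: "a \<in> A" "pairing_gauge (a - (0, y' - z')) \<le> \<epsilon> / 2"
    using dense \<open>\<epsilon> > 0\<close> unfolding quasidense_iff by (meson half_gt_zero)
  obtain s s' where s: "a = (s, s')" by (cases a)
  define w where "w = s' - (y' - z')"
  have "(norm s)\<^sup>2 / 2 + (norm w)\<^sup>2 / 2 + w s \<le> \<epsilon> / 2"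
    using a(2) by (simp add: s w_def pairing_gauge_def self_pairing_def pairing_def norm_Pair add_divide_distrib)
  moreover have "- z' s \<le> m * norm s"
    using norm_blinfun[of z' s] mult_right_mono[OF z'(1), of "norm s"] by simp
  moreover have "- y'' w \<le> m * norm w"
    using norm_blinfun[of y'' w] by (simp add: m_def)
  moreover have "0 \<le> (norm s - m)\<^sup>2" "0 \<le> (norm w - m)\<^sup>2" by simp_all
  ultimately have "w s - z' s - y'' w + y'' z' \<le> \<epsilon>"
    using z'(2) by (simp add: power2_diff algebra_simps)
  moreover have "w s - z' s - y'' w + y'' z' = s' s - y' s - y'' s' + y'' y'"
    by (simp add: w_def blinfun.diff_left blinfun.diff_right)
  ultimately show ?thesis
    using a(1) by (intro bexI[of _ a]) (auto simp: s pairing_def)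
qed

section \<open>The characterisation of quasidensity\<close>

theorem theorem4p8:
  fixes f :: "'a::banach \<times> 'a dual \<Rightarrow> ereal"
  assumes nonzero: "\<exists>x::'a. x \<noteq> 0"
    and range: "avoids_minf f"
    and proper: "proper_fun f"
    and convex: "convex_ereal f"
    and lsc: "lsc f"
    and ge_pairing: "\<And>x x'. f (x, x') \<ge> ereal (pairing x x')"
  shows "quasidense {(x, x'). f (x, x') = ereal (pairing x x')} \<longleftrightarrow>
    (\<forall>y' y''. fenchel_conj f (y', y'') \<ge> ereal (pairing y' y''))"
proof
  assume dense: "quasidense {(x, x'). f (x, x') = ereal (pairing x x')}"
  have "ereal (pairing y' y'') \<le> fenchel_conj f (y', y'') + ereal \<epsilon>"
    if "\<epsilon> > 0" for y' :: "'a dual" and y'' and \<epsilon> :: real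
  proof -
    from quasidense_negative_alignment[OF dense that, of y' y'']
    obtain s s' where s: "f (s, s') = ereal (pairing s s')"
      "pairing y' y'' - \<epsilon> \<le> pairing s y' + pairing s' y'' - pairing s s'" by auto
    have "ereal (pairing y' y'' - \<epsilon>) \<le> ereal (pairing s y' + pairing s' y'') - f (s, s')"
      using s by simp
    also have "\<dots> \<le> fenchel_conj f (y', y'')"
      unfolding fenchel_conj_def prod.case by (intro SUP_upper2[of "(s, s')"]) auto
    finally show ?thesis
      by (cases "fenchel_conj f (y', y'')") auto
  qed
  then show "\<forall>y' y''. fenchel_conj f (y', y'') \<ge> ereal (pairing y' y'')"
    by (blast intro: ereal_le_epsilon2)
next
  assume conj: "\<forall>y' y''. fenchel_conj f (y', y'') \<ge> ereal (pairing y' y'')"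
  define D where "D = {z. f z \<noteq> \<infinity>}"
  define F where "F z = real_of_ereal (f z)" for z
  have f_eq: "f z = ereal (F z)" if "z \<in> D" for z
    using that range[unfolded avoids_minf_def, rule_format, of z]
    by (cases "f z") (auto simp: D_def F_def)
  have f_ge: "ereal (self_pairing z) \<le> f z" for z
    using ge_pairing[of "fst z" "snd z"] by (simp add: self_pairing_def)
  obtain z where "\<bar>f z\<bar> \<noteq> \<infinity>" using proper unfolding proper_fun_def by (elim exE)
  then have "z \<in> D" by (auto simp: D_def)
  then have nonempty: "D \<noteq> {}" by blast
  have f_convex: "f (u *\<^sub>R x + v *\<^sub>R y) \<le> ereal (u * F x + v * F y)"
    if "x \<in> D" "y \<in> D" "u > 0" "v > 0" "u + v = 1" for x y u v
  proof -
    have "f (u *\<^sub>R x + v *\<^sub>R y) \<le> ereal u * f x + ereal v * f y"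
      using convex[unfolded convex_ereal_def, rule_format, OF that(3-5)] .
    then show ?thesis by (simp add: f_eq[OF that(1)] f_eq[OF that(2)])
  qed
  have D: "u *\<^sub>R x + v *\<^sub>R y \<in> D"
    if "x \<in> D" "y \<in> D" "u > 0" "v > 0" "u + v = 1" for x y u v
    unfolding D_def mem_Collect_eq
  proof
    assume "f (u *\<^sub>R x + v *\<^sub>R y) = \<infinity>"
    from f_convex[OF that, unfolded this] show False by simp
  qed
  have F: "F (u *\<^sub>R x + v *\<^sub>R y) \<le> u * F x + v * F y"
    if "x \<in> D" "y \<in> D" "u > 0" "v > 0" "u + v = 1" for x y u v
    using f_convex[OF that] unfolding f_eq[OF D[OF that]] ereal_less_eq(3) .
  have F_convex: "convex_on D F"
  proof (rule convex_onI)
    show "convex D" unfolding convex_alt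
    proof (intro ballI allI impI)
      fix x y u assume xy: "x \<in> D" "y \<in> D" and u: "0 \<le> u \<and> u \<le> (1::real)"
      consider "u = 0" | "u = 1" | "0 < 1 - u" "0 < u" using u by linarith
      then show "(1 - u) *\<^sub>R x + u *\<^sub>R y \<in> D"
      proof cases
        case 3
        then show ?thesis by (rule D[OF xy]) simp
      qed (simp_all add: xy)
    qed
  next
    fix t :: real and x y assume "t > 0" "t < 1" and xy: "x \<in> D" "y \<in> D"
    then show "F ((1 - t) *\<^sub>R x + t *\<^sub>R y) \<le> (1 - t) * F x + t * F y"
      by (intro F[OF xy]) simp_all
  qed
  show "quasidense {(x, x'). f (x, x') = ereal (pairing x x')}"
  proof (rule quasidense_of_gap_plus_gauge_small[OF F_convex _ nonempty])
    show F_ge: "self_pairing z \<le> F z" if "z \<in> D" for z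
      using f_ge[of z] f_eq[OF that] by simp
  next
    fix b a assume b: "\<And>n. b n \<in> D" "b \<longlonglongrightarrow> a" "(\<lambda>n. F (b n) - self_pairing (b n)) \<longlonglongrightarrow> 0"
    have "(\<lambda>n. self_pairing (b n)) \<longlonglongrightarrow> self_pairing a"
      unfolding self_pairing_def pairing_def using b(2) by (intro tendsto_intros)
    from tendsto_add[OF b(3) this] have lim: "(\<lambda>n. F (b n)) \<longlonglongrightarrow> self_pairing a" by simp
    have "f a \<le> ereal (self_pairing a)"
    proof (rule ccontr)
      assume "\<not> ?thesis"
      then obtain k where k: "ereal (self_pairing a) < ereal k" "ereal k < f a"
        using ereal_dense2[of "ereal (self_pairing a)" "f a"] by (auto simp: not_le)
      have "\<forall>\<^sub>F n in sequentially. ereal k < f (b n)"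
        using lsc k(2) b(2) unfolding lsc_def filterlim_iff by blast
      moreover have "\<forall>\<^sub>F n in sequentially. F (b n) < k"
        using lim k(1) by (intro order_tendstoD(2)) auto
      ultimately have "\<forall>\<^sub>F n in sequentially. False"
        by eventually_elim (use f_eq[OF b(1)] in auto)
      then show False by simp
    qed
    then show "a \<in> {(x, x'). f (x, x') = ereal (pairing x x')}"
      using f_ge[of a] by (auto simp: self_pairing_def intro: antisym)
  next
    fix c :: "'a \<times> 'a dual" and \<epsilon> :: real assume "\<epsilon> > 0"
    show "\<exists>b\<in>D. F b - self_pairing b + pairing_gauge (b - c) \<le> \<epsilon>"
    proof (rule gap_plus_gauge_small[OF F_convex nonempty _ \<open>\<epsilon> > 0\<close>])
      fix y' :: "'a dual" and y'' M
      assume M: "\<And>x x'. (x, x') \<in> D \<Longrightarrow> pairing x y' + pairing x' y'' - F (x, x') \<le> M"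
      have "ereal (pairing x y' + pairing x' y'') - f (x, x') \<le> ereal M" for x x'
        using M[of x x'] f_eq[of "(x, x')"] by (cases "(x, x') \<in> D") (auto simp: D_def)
      then have "fenchel_conj f (y', y'') \<le> ereal M"
        unfolding fenchel_conj_def prod.case by (intro SUP_least) auto
      then show "pairing y' y'' \<le> M"
        using conj by (meson ereal_less_eq(3) order_trans)
    qed
  qed
qed

end
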